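(* Let $\rho=\frac{\lambda z_0}{\ell A}$ and suppose that $\frac1\rho\in\mathbb{N}$ and $m\le\frac{\delta}{2}e^{K^2/2}$ for some $\delta>0$ and $K>0$. Then with probability (over the sensor ensemble) greater than $$1-2\delta-\frac{\rho\,n^2(n^2-1)^{3/2}}{m^{1/2}},$$ all target vectors $X\in\mathbb C^m$ of sparsity $$s<\frac12\left(1+\frac{n}{2K^2}\right)$$ can be recovered exactly, by Basis Pursuit as well as by Orthogonal Matching Pursuit, from $Y=\mathbf A^{\rm RM}X$, where $\mathbf A^{\rm RM}$ is the response-matrix sensing matrix.
   Context: Fix real numbers $z_0,\ell,A,\lambda>0$ and set $\omega=2\pi/\lambda$. Let $m$ be a perfect square. Target grid: $\mathcal{M}=\{\mathbf r_j=(x_j,y_j,z_0): j=1,\dots,m\}$ is a $\sqrt m\times\sqrt m$ square lattice of mesh size $\ell$ in the plane $\{z=z_0\}$. Sensor ensemble: the sensors are $\mathbf a_q=(\xi_q,\eta_q,0)$, $q=1,\dots,n$, where $(\xi_q,\eta_q)$ are i.i.d. uniformly distributed in $[0,A]\times[0,A]$. Let $G(\mathbf r,\mathbf a)=\frac{e^{i\omega z_0}}{4\pi z_0}e^{i\omega|x-\xi|^2/(2z_0)}e^{i\omega|y-\eta|^2/(2z_0)}$ be the paraxial Green function for $\mathbf r=(x,y,z_0)$, $\mathbf a=(\xi,\eta,0)$. The response-matrix (RM) sensing matrix $\mathbf A^{\rm RM}$ is the $n^2\times m$ matrix whose rows are indexed by transmitter–receiver pairs $(p,q)\in\{1,\dots,n\}^2$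 and whose entries are $G(\mathbf a_p,\mathbf r_j)G(\mathbf r_j,\mathbf a_q)$, normalized so that columns have unit $\ell^2$-norm; i.e. up to a constant unimodular factor $$A^{\rm RM}_{(p,q),j}=\frac1n\exp\!\Big(\tfrac{i\omega}{2z_0}\big[(x_j-\xi_p)^2+(y_j-\eta_p)^2+(x_j-\xi_q)^2+(y_j-\eta_q)^2\big]\Big).$$ The sparsity of $X$ is $s=\|X\|_0$, its number of nonzero entries. Basis Pursuit (BP): given $Y$, solve $\min\|Z\|_1$ subject to $\mathbf A^{\rm RM} Z=Y$; exact recovery means $X$ is the unique minimizer. Orthogonal Matching Pursuit (OMP): start with residual $Y$ and empty index set; at each step add an index of a column having maximal absolute inner product with the current residual, and replace the residual by $Y$ minus its orthogonal projection onto the span of the selected columns; exact recovery means that after $s$ steps the least-squares coefficients on the selected columns give $X$. *)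

theory Defs
  imports "HOL-Analysis.Analysis" "HOL-Probability.Probability"
begin

section \<open>Recovery of sparse vectors\<close>

definition sparsity :: "complex^'m::finite \<Rightarrow> nat" where
  "sparsity X = card {j. X $ j \<noteq> 0}"

definition l1_norm :: "complex^'m::finite \<Rightarrow> real" where
  "l1_norm X = (\<Sum>j\<in>UNIV. norm (X $ j))"

text \<open>The real inner product of the library on \<open>complex^'r\<close> is the real part of the following
  Hermitian one, and \<open>span\<close> is the real span; the complex span is \<open>vec.span\<close>.\<close>

definition herm_inner :: "complex^'r::finite \<Rightarrow> complex^'r \<Rightarrow> complex" where
  "herm_inner u v = (\<Sum>i\<in>UNIV. cnj (u $ i) * v $ i)"

definition orth_proj :: "(complex^'r::finite) set \<Rightarrow> complex^'r \<Rightarrow> complex^'r" where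
  "orth_proj W y = (THE p. p \<in> W \<and> (\<forall>w\<in>W. herm_inner w (y - p) = 0))"

lemma Re_herm_inner: "Re (herm_inner u v) = inner u v"
  by (simp add: herm_inner_def inner_vec_def inner_complex_def Re_sum)

lemma herm_inner_scale_left: "herm_inner (c *s u) v = cnj c * herm_inner u v"
  by (simp add: herm_inner_def sum_distrib_left mult.assoc)

lemma orth_proj_ex1:
  fixes W :: "(complex^'r::finite) set"
  assumes "vec.subspace W"
  shows "\<exists>!p. p \<in> W \<and> (\<forall>w\<in>W. herm_inner w (y - p) = 0)"
proof -
  have scale: "r *\<^sub>R u = complex_of_real r *s u" for r and u :: "complex^'r"
    by (simp add: vec_eq_iff) (simp add: scaleR_conv_of_real)
  have sub: "subspace W"
    unfolding subspace_def using assms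
    by (auto simp: scale vec.subspace_0 vec.subspace_add vec.subspace_scale)
  then have sp: "span W = W" by (simp add: span_eq_iff)
  obtain p q where p: "p \<in> W" and q: "\<And>w. w \<in> W \<Longrightarrow> orthogonal q w" and y: "y = p + q"
    using orthogonal_subspace_decomp_exists[of W y] sp by metis
  have herm: "herm_inner w q = 0" if w: "w \<in> W" for w
  proof -
    have "\<i> *s w \<in> W" using assms w by (rule vec.subspace_scale)
    then have "Re (herm_inner (\<i> *s w) q) = 0" "Re (herm_inner w q) = 0"
      using q w by (simp_all add: Re_herm_inner orthogonal_def inner_commute[of _ q])
    then show ?thesis by (simp add: herm_inner_scale_left complex_eq_iff)
  qed
  show ?thesis
  proof (rule ex1I[of _ p])
    show "p \<in> W \<and> (\<forall>w\<in>W. herm_inner w (y - p) = 0)" using p herm y by simp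
  next
    fix p' assume p': "p' \<in> W \<and> (\<forall>w\<in>W. herm_inner w (y - p') = 0)"
    have d: "p' - p \<in> W" using p p' assms by (simp add: vec.subspace_diff)
    have "inner (p' - p) (y - p') = 0" "inner (p' - p) (y - p) = 0"
      using d p' herm[OF d] y by (auto simp flip: Re_herm_inner)
    then have "inner (p' - p) (p' - p) = 0" by (simp add: inner_diff_right)
    then show "p' = p" by simp
  qed
qed

definition bp_recovers :: "complex^'m::finite^'r::finite \<Rightarrow> complex^'m \<Rightarrow> bool" where
  "bp_recovers A X \<longleftrightarrow> {Z. is_arg_min l1_norm (\<lambda>Z. A *v Z = A *v X) Z} = {X}"

text \<open>\<open>omp_run A Y k S R\<close>: orthogonal matching pursuit with data \<open>Y\<close> can arrive, after \<open>k\<close> steps, at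
  the index set \<open>S\<close> and the residual \<open>R\<close>. It is a relation because the index with maximal
  correlation need not be unique.\<close>

inductive omp_run ::
  "complex^'m::finite^'r::finite \<Rightarrow> complex^'r \<Rightarrow> nat \<Rightarrow> 'm set \<Rightarrow> complex^'r \<Rightarrow> bool"
  for A :: "complex^'m^'r" and Y :: "complex^'r" where
  start: "omp_run A Y 0 {} Y"
| step: "omp_run A Y k S R \<Longrightarrow>
    (\<And>i. norm (herm_inner (column i A) R) \<le> norm (herm_inner (column j A) R)) \<Longrightarrow>
    omp_run A Y (Suc k) (insert j S)
      (Y - orth_proj (vec.span ((\<lambda>i. column i A) ` insert j S)) Y)"

text \<open>Recovery is required for every way of breaking ties, and the least-squares coefficients on the
  selected columns have to be unique.\<close>

definition omp_recovers :: "complex^'m::finite^'r::finite \<Rightarrow> complex^'m \<Rightarrow> bool" where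
  "omp_recovers A X \<longleftrightarrow>
    (\<forall>S R. omp_run A (A *v X) (sparsity X) S R \<longrightarrow>
      {Z. is_arg_min (\<lambda>Z. norm (A *v X - A *v Z)) (\<lambda>Z. {j. Z $ j \<noteq> 0} \<subseteq> S) Z} = {X})"

lemma omp_run_exists: "\<exists>S R. omp_run A Y k S R"
proof (induction k)
  case 0
  show ?case by (meson omp_run.start)
next
  case (Suc k)
  then obtain S R where SR: "omp_run A Y k S R" by blast
  let ?f = "\<lambda>i. norm (herm_inner (column i A) R)"
  have "Max (range ?f) \<in> range ?f" by (rule Max_in) auto
  then obtain j where "Max (range ?f) = ?f j" by blast
  then have "?f i \<le> ?f j" for i using Max_ge[of "range ?f" "?f i"] by simp
  then show ?case using omp_run.step[OF SR, of j] by blast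
qed

section \<open>Imaging geometry\<close>

text \<open>Targets lie in the plane \<open>z = z0\<close> and sensors in the plane \<open>z = 0\<close>; points are represented by
  their transverse coordinates. The lattice is parallel to the axes, with arbitrary corner
  \<open>(x0, y0)\<close> and arbitrary enumeration.\<close>

definition square_lattice :: "real \<Rightarrow> ('m::finite \<Rightarrow> real \<times> real) \<Rightarrow> bool" where
  "square_lattice ell r \<longleftrightarrow>
    (\<exists>N x0 y0. CARD('m) = N ^ 2 \<and>
      bij_betw r UNIV
        ((\<lambda>(k, l). (x0 + real k * ell, y0 + real l * ell)) ` ({..<N} \<times> {..<N})))"

definition paraxial_green :: "real \<Rightarrow> real \<Rightarrow> real \<times> real \<Rightarrow> real \<times> real \<Rightarrow> complex" where
  "paraxial_green \<omega> z0 r a =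
    exp (\<i> * of_real (\<omega> * z0)) / of_real (4 * pi * z0)
      * exp (\<i> * of_real (\<omega> * \<bar>fst r - fst a\<bar>\<^sup>2 / (2 * z0)))
      * exp (\<i> * of_real (\<omega> * \<bar>snd r - snd a\<bar>\<^sup>2 / (2 * z0)))"

definition rm_response ::
  "real \<Rightarrow> real \<Rightarrow> ('m \<Rightarrow> real \<times> real) \<Rightarrow> ('n \<Rightarrow> real \<times> real)
    \<Rightarrow> complex^'m::finite^('n::finite \<times> 'n)" where
  "rm_response \<omega> z0 r a =
    (\<chi> pq j. paraxial_green \<omega> z0 (a (fst pq)) (r j) * paraxial_green \<omega> z0 (r j) (a (snd pq)))"

definition rm_matrix ::
  "real \<Rightarrow> real \<Rightarrow> ('m \<Rightarrow> real \<times> real) \<Rightarrow> ('n \<Rightarrow> real \<times> real)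
    \<Rightarrow> complex^'m::finite^('n::finite \<times> 'n)" where
  "rm_matrix \<omega> z0 r a =
    (\<chi> pq j. rm_response \<omega> z0 r a $ pq $ j / of_real (norm (column j (rm_response \<omega> z0 r a))))"

lemma norm_paraxial_green: "z0 > 0 \<Longrightarrow> norm (paraxial_green \<omega> z0 r a) = 1 / (4 * pi * z0)"
  by (simp add: paraxial_green_def norm_mult norm_divide)

lemma rm_matrix_entry:
  fixes r :: "'m::finite \<Rightarrow> real \<times> real" and a :: "'n::finite \<Rightarrow> real \<times> real"
  assumes z0: "z0 > 0"
  shows "rm_matrix \<omega> z0 r a $ (p, q) $ j =
    exp (\<i> * of_real (2 * \<omega> * z0)) * (1 / of_nat CARD('n) *
      exp (\<i> * of_real (\<omega> / (2 * z0) *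
        ((fst (r j) - fst (a p))\<^sup>2 + (snd (r j) - snd (a p))\<^sup>2
          + (fst (r j) - fst (a q))\<^sup>2 + (snd (r j) - snd (a q))\<^sup>2))))"
proof -
  define c where "c = 1 / (4 * pi * z0)"
  have c: "c > 0" using z0 by (simp add: c_def)
  have "norm (column j (rm_response \<omega> z0 r a)) = sqrt (\<Sum>pq\<in>(UNIV::('n \<times> 'n) set). (c * c)\<^sup>2)"
    by (simp add: norm_vec_def L2_set_def column_def rm_response_def norm_mult
        norm_paraxial_green[OF z0] c_def)
  also have "\<dots> = real CARD('n) * (c * c)"
    using c by (simp add: card_prod real_sqrt_mult)
  finally have nrm: "norm (column j (rm_response \<omega> z0 r a)) = real CARD('n) * (c * c)" .
  have g: "paraxial_green \<omega> z0 u v =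
      of_real c * exp (\<i> * of_real (\<omega> * z0 + \<omega> / (2 * z0) * ((fst u - fst v)\<^sup>2 + (snd u - snd v)\<^sup>2)))"
    for u v :: "real \<times> real"
  proof -
    have "\<i> * of_real (\<omega> * z0 + \<omega> / (2 * z0) * ((fst u - fst v)\<^sup>2 + (snd u - snd v)\<^sup>2))
      = \<i> * of_real (\<omega> * z0) + \<i> * of_real (\<omega> * \<bar>fst u - fst v\<bar>\<^sup>2 / (2 * z0))
        + \<i> * of_real (\<omega> * \<bar>snd u - snd v\<bar>\<^sup>2 / (2 * z0))"
      by (simp add: ring_distribs add_divide_distrib)
    then show ?thesis by (simp only: exp_add paraxial_green_def c_def) simp
  qed
  have "rm_matrix \<omega> z0 r a $ (p, q) $ j =
      (of_real c * of_real c) * (exp (\<i> * of_real (\<omega> * z0 + \<omega> / (2 * z0) *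
          ((fst (a p) - fst (r j))\<^sup>2 + (snd (a p) - snd (r j))\<^sup>2)))
        * exp (\<i> * of_real (\<omega> * z0 + \<omega> / (2 * z0) *
          ((fst (r j) - fst (a q))\<^sup>2 + (snd (r j) - snd (a q))\<^sup>2))))
      / (of_nat CARD('n) * (of_real c * of_real c))"
    by (simp add: rm_matrix_def nrm) (simp add: rm_response_def g)
  also have "\<dots> = 1 / of_nat CARD('n) * exp (\<i> * of_real (\<omega> * z0 + \<omega> / (2 * z0) *
          ((fst (a p) - fst (r j))\<^sup>2 + (snd (a p) - snd (r j))\<^sup>2))
        + \<i> * of_real (\<omega> * z0 + \<omega> / (2 * z0) *
          ((fst (r j) - fst (a q))\<^sup>2 + (snd (r j) - snd (a q))\<^sup>2)))"
    using c by (simp add: exp_add)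
  also have "\<i> * of_real (\<omega> * z0 + \<omega> / (2 * z0) *
          ((fst (a p) - fst (r j))\<^sup>2 + (snd (a p) - snd (r j))\<^sup>2))
        + \<i> * of_real (\<omega> * z0 + \<omega> / (2 * z0) *
          ((fst (r j) - fst (a q))\<^sup>2 + (snd (r j) - snd (a q))\<^sup>2))
      = \<i> * of_real (2 * \<omega> * z0) + \<i> * of_real (\<omega> / (2 * z0) *
        ((fst (r j) - fst (a p))\<^sup>2 + (snd (r j) - snd (a p))\<^sup>2
          + (fst (r j) - fst (a q))\<^sup>2 + (snd (r j) - snd (a q))\<^sup>2))"
    by (simp add: power2_commute[of "fst (a p)"] power2_commute[of "snd (a p)"] ring_distribs)
  finally show ?thesis by (simp only: exp_add) simp
qed

end

(* The inner product of two columns of the response matrix is, up to a unimodular factor, the square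
   of S / n, where S is the sum of n independent characters of the torus evaluated at uniform points.
   As 1 / rho is an integer, these characters are nontrivial, so every summand has mean zero.
   Hoeffding's inequality along three axes at angles of 60 degrees gives
   |S| <= K sqrt (2 n) except with probability 6 exp (- 3 K^2 / 4). Since S depends on the two targets
   only through their difference, a union bound over the 4 (m - sqrt m) nonzero differences suffices.
   The coherence is then at most 2 K^2 / n, which for the given sparsity implies recovery by both
   algorithms. The total failure probability is at most 3 delta / 2 (when delta <= 1 / 2), so the
   term with rho in the claimed bound only adds slack. *)
theory Submission
  imports Defs
begin

section \<open>Recovery from small coherence\<close>

lemma herm_inner_zero_right [simp]: "herm_inner u 0 = 0"
  by (simp add: herm_inner_def)

lemma herm_inner_matrix_vector:
  "herm_inner u (B *v W) = (\<Sum>k\<in>UNIV. herm_inner u (column k B) * W $ k)"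
  unfolding herm_inner_def matrix_vector_mult_def column_def
  by (simp add: sum_distrib_left sum_distrib_right mult.assoc, subst sum.swap, simp)

text \<open>The clause \<open>0 \<le> \<mu>\<close> is separate because with a single column the
  last clause is vacuous and would leave the sign of \<mu> open.\<close>

definition coherence_bound :: "complex^'m::finite^'r::finite \<Rightarrow> real \<Rightarrow> bool" where
  "coherence_bound B \<mu> \<longleftrightarrow> 0 \<le> \<mu> \<and> (\<forall>j. herm_inner (column j B) (column j B) = 1) \<and>
    (\<forall>j k. j \<noteq> k \<longrightarrow> norm (herm_inner (column j B) (column k B)) \<le> \<mu>)"

lemma coherence_boundD:
  assumes "coherence_bound B \<mu>"
  shows "0 \<le> \<mu>" "herm_inner (column j B) (column j B) = 1"
    "j \<noteq> k \<Longrightarrow> norm (herm_inner (column j B) (column k B)) \<le> \<mu>"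
  using assms by (auto simp: coherence_bound_def)

text \<open>The diagonal of the Gram matrix reproduces \<open>W $ j\<close> exactly, so the error
  consists of off-diagonal entries only. Both algorithms are analysed through this estimate.\<close>

lemma coherence_bound_correlation:
  assumes "coherence_bound B \<mu>"
  shows "norm (herm_inner (column j B) (B *v W) - W $ j) \<le> \<mu> * (\<Sum>k\<in>UNIV - {j}. norm (W $ k))"
proof -
  have "herm_inner (column j B) (B *v W) - W $ j
      = (\<Sum>k\<in>UNIV - {j}. herm_inner (column j B) (column k B) * W $ k)"
    by (simp add: herm_inner_matrix_vector sum.remove[of UNIV j] coherence_boundD(2)[OF assms])
  also have "norm \<dots> \<le> (\<Sum>k\<in>UNIV - {j}. \<mu> * norm (W $ k))"
    using coherence_boundD(3)[OF assms]
    by (intro sum_norm_le) (auto simp: norm_mult intro!: mult_right_mono)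
  finally show ?thesis by (simp add: sum_distrib_left)
qed

section \<open>Basis pursuit through the null space property\<close>

lemma l1_norm_nonneg: "0 \<le> l1_norm X"
  by (simp add: l1_norm_def sum_nonneg)

lemma l1_norm_pos: "X \<noteq> 0 \<Longrightarrow> 0 < l1_norm X"
  using l1_norm_nonneg[of X]
  by (auto simp: l1_norm_def vec_eq_iff sum_nonneg_eq_0_iff order_less_le)

text \<open>For a kernel vector all correlations vanish, so each coordinate is at most \<mu> times
  the mass of the others, that is, at most a fraction \<open>\<mu> / (1 + \<mu>)\<close> of the
  total mass. Summation over \<open>T\<close> gives the claim.\<close>

lemma coherence_bound_null_space:
  assumes "coherence_bound B \<mu>" and "B *v W = 0"
  shows "(1 + \<mu>) * (\<Sum>j\<in>T. norm (W $ j)) \<le> real (card T) * \<mu> * l1_norm W"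
proof -
  have "(1 + \<mu>) * norm (W $ j) \<le> \<mu> * l1_norm W" for j
  proof -
    have "norm (W $ j) \<le> \<mu> * (\<Sum>k\<in>UNIV - {j}. norm (W $ k))"
      using coherence_bound_correlation[OF assms(1), of j W] assms(2) by simp
    also have "(\<Sum>k\<in>UNIV - {j}. norm (W $ k)) = l1_norm W - norm (W $ j)"
      by (simp add: l1_norm_def sum.remove[of UNIV j])
    finally show ?thesis by (simp add: algebra_simps)
  qed
  then have "(\<Sum>j\<in>T. (1 + \<mu>) * norm (W $ j)) \<le> (\<Sum>j\<in>T. \<mu> * l1_norm W)"
    by (intro sum_mono)
  then show ?thesis by (simp add: sum_distrib_left mult.assoc)
qed

text \<open>A competitor differs from \<open>X\<close> by a kernel vector \<open>h\<close> with less
  than half of its mass on the support of \<open>X\<close>. The mass gained off the support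
  therefore exceeds what can be lost on it.\<close>

lemma coherence_bound_bp_recovers:
  assumes coh: "coherence_bound B \<mu>" and s: "2 * real (sparsity X) * \<mu> < 1 + \<mu>"
  shows "bp_recovers B X"
proof -
  define T where "T = {j. X $ j \<noteq> 0}"
  have less: "l1_norm X < l1_norm Z" if eq: "B *v Z = B *v X" and ne: "Z \<noteq> X" for Z
  proof -
    define h where "h = Z - X"
    have Bh: "B *v h = 0" using eq by (simp add: h_def matrix_vector_mult_diff_distrib)
    have pos: "0 < l1_norm h" using ne by (intro l1_norm_pos) (simp add: h_def)
    have "2 * ((1 + \<mu>) * (\<Sum>j\<in>T. norm (h $ j))) \<le> 2 * (real (card T) * \<mu> * l1_norm h)"
      using coherence_bound_null_space[OF coh Bh, of T] by simp
    also have "\<dots> = (2 * real (card T) * \<mu>) * l1_norm h" by simp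
    also have "\<dots> < (1 + \<mu>) * l1_norm h"
      using s pos unfolding sparsity_def T_def by (intro mult_strict_right_mono)
    finally have "(1 + \<mu>) * (2 * (\<Sum>j\<in>T. norm (h $ j))) < (1 + \<mu>) * l1_norm h"
      by (simp add: mult.left_commute)
    then have half: "2 * (\<Sum>j\<in>T. norm (h $ j)) < l1_norm h"
      using coherence_boundD(1)[OF coh] by (simp add: mult_less_cancel_left)
    have split: "l1_norm V = (\<Sum>j\<in>T. norm (V $ j)) + (\<Sum>j\<in>-T. norm (V $ j))" for V
      unfolding l1_norm_def by (metis Compl_eq_Diff_UNIV finite sum.subset_diff add.commute subset_UNIV)
    \<comment> \<open>On the support, the reverse triangle inequality limits the loss to the mass of
      \<open>h\<close> there.\<close>
    have 1: "(\<Sum>j\<in>T. norm (X $ j)) - (\<Sum>j\<in>T. norm (h $ j)) \<le> (\<Sum>j\<in>T. norm (Z $ j))"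
      unfolding sum_subtractf[symmetric] h_def
      by (intro sum_mono) (metis norm_minus_commute norm_triangle_ineq2 vector_minus_component
          diff_le_eq add.commute)
    have 2: "(\<Sum>j\<in>-T. norm (X $ j)) = 0" by (simp add: T_def)
    have 3: "(\<Sum>j\<in>-T. norm (Z $ j)) = (\<Sum>j\<in>-T. norm (h $ j))"
      by (intro sum.cong) (auto simp: T_def h_def)
    show ?thesis using half split[of h] split[of X] split[of Z] 1 2 3 by linarith
  qed
  show ?thesis
    unfolding bp_recovers_def is_arg_min_def
  proof (intro set_eqI iffI; clarsimp)
    fix Z assume "B *v Z = B *v X" "\<forall>V. B *v V = B *v X \<longrightarrow> \<not> l1_norm V < l1_norm Z"
    then show "Z = X" using less[of Z] by blast
  next
    fix V assume "B *v V = B *v X" "l1_norm V < l1_norm X"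
    then show False using less[of V] by (cases "V = X") auto
  qed
qed

section \<open>Orthogonal matching pursuit\<close>

text \<open>At an index \<open>i\<close> of a largest entry of \<open>W\<close>, the correlation is
  at least \<open>1 - \<mu> * (card T - 1)\<close> times that entry. Off \<open>T\<close> it is at
  most \<open>\<mu> * card T\<close> times it, and the hypothesis on \<open>card T\<close> separates
  the two. Strict positivity also shows that the columns in \<open>T\<close> are
  independent.\<close>

lemma coherence_bound_dominant_correlation:
  assumes coh: "coherence_bound B \<mu>" and s: "2 * real (card T) * \<mu> < 1 + \<mu>"
    and supp: "{j. W $ j \<noteq> 0} \<subseteq> T" and W: "W \<noteq> 0"
  obtains i where "\<And>j. j \<notin> T \<Longrightarrow>
    norm (herm_inner (column j B) (B *v W)) < norm (herm_inner (column i B) (B *v W))"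
    "0 < norm (herm_inner (column i B) (B *v W))"
proof -
  have mu: "0 \<le> \<mu>" using coh by (rule coherence_boundD)
  let ?f = "\<lambda>j. norm (W $ j)"
  have "Max (range ?f) \<in> range ?f" by (rule Max_in) auto
  then obtain i where i: "Max (range ?f) = ?f i" by blast
  then have le: "?f j \<le> ?f i" for j using Max_ge[of "range ?f" "?f j"] by simp
  obtain l where "W $ l \<noteq> 0" using W by (auto simp: vec_eq_iff)
  then have pos: "0 < ?f i" using le[of l] by (meson order_less_le_trans zero_less_norm_iff)
  have iT: "i \<in> T" using supp pos by auto
  have tail: "(\<Sum>k\<in>UNIV - {j}. ?f k) \<le> real (card (T - {j})) * ?f i" for j
  proof -
    have "(\<Sum>k\<in>UNIV - {j}. ?f k) = (\<Sum>k\<in>T - {j}. ?f k)"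
      using supp by (intro sum.mono_neutral_right) auto
    also have "\<dots> \<le> (\<Sum>k\<in>T - {j}. ?f i)" by (intro sum_mono le)
    finally show ?thesis by simp
  qed
  have err: "norm (herm_inner (column j B) (B *v W) - W $ j) \<le> \<mu> * (real (card (T - {j})) * ?f i)" for j
    using coherence_bound_correlation[OF coh, of j W] mult_left_mono[OF tail[of j] mu] by linarith
  \<comment> \<open>The term saved by \<open>i \<in> T\<close> is what makes the threshold
    \<open>1 + \<mu>\<close> instead of 1.\<close>
  have cT: "real (card (T - {i})) = real (card T) - 1"
    using card.remove[of T i] iT by simp
  have "norm (W $ i) - norm (herm_inner (column i B) (B *v W)) \<le> \<mu> * ((real (card T) - 1) * ?f i)"
    using err[of i] norm_triangle_ineq3[of "herm_inner (column i B) (B *v W)" "W $ i"] cT by simp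
  then have low: "(1 - \<mu> * (real (card T) - 1)) * ?f i \<le> norm (herm_inner (column i B) (B *v W))"
    by (simp add: algebra_simps)
  have "(\<mu> * real (card T)) * ?f i < (1 - \<mu> * (real (card T) - 1)) * ?f i"
    using s pos by (intro mult_strict_right_mono) (auto simp: algebra_simps)
  then have up: "\<mu> * (real (card T) * ?f i) < norm (herm_inner (column i B) (B *v W))"
    using low by (simp add: mult.assoc)
  show ?thesis
  proof
    fix j assume j: "j \<notin> T"
    then have "W $ j = 0" "T - {j} = T" using supp by auto
    then show "norm (herm_inner (column j B) (B *v W)) < norm (herm_inner (column i B) (B *v W))"
      using err[of j] up by simp
  qed (use up mu in \<open>meson mult_nonneg_nonneg of_nat_0_le_iff norm_ge_zero le_less_trans\<close>)
qed

lemma vec_span_columns: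
  assumes "v \<in> vec.span ((\<lambda>i. column i B) ` S)"
  obtains Z where "{j. Z $ j \<noteq> 0} \<subseteq> S" "v = B *v Z"
proof -
  have "\<exists>Z. {j. Z $ j \<noteq> 0} \<subseteq> S \<and> v = B *v Z"
    using assms
  proof (induction rule: vec.span_induct_alt)
    case base
    show ?case by (rule exI[of _ 0]) simp
  next
    case (step c x y)
    then obtain i Z where i: "i \<in> S" "x = column i B" and Z: "{j. Z $ j \<noteq> 0} \<subseteq> S" "y = B *v Z"
      by blast
    have "B *v (axis i c) = c *s column i B"
      by (simp add: vec_eq_iff matrix_vector_mult_def column_def axis_def if_distrib[of "(*) _"] cong: if_cong)
    then have "c *s x + y = B *v (axis i c + Z)"
      by (simp add: i Z matrix_vector_right_distrib)
    moreover have "{j. (axis i c + Z) $ j \<noteq> 0} \<subseteq> S"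
      using i Z by (auto simp: axis_def split: if_splits)
    ultimately show ?case by blast
  qed
  then show ?thesis using that by blast
qed

text \<open>The residual is the image of a nonzero vector supported in the support of
  \<open>X\<close>, so a dominant correlation lies there. Orthogonality to the columns already
  selected rules out repetition, hence every step finds a new support index.\<close>

lemma omp_run_invariant:
  fixes B :: "complex^'m::finite^'r::finite"
  assumes coh: "coherence_bound B \<mu>" and s: "2 * real (sparsity X) * \<mu> < 1 + \<mu>"
    and run: "omp_run B (B *v X) k S R" and k: "k \<le> sparsity X"
  shows "S \<subseteq> {j. X $ j \<noteq> 0} \<and> card S = k \<and> (\<forall>i\<in>S. herm_inner (column i B) R = 0) \<and>
    (\<exists>Z. {j. Z $ j \<noteq> 0} \<subseteq> S \<and> R = B *v (X - Z))"
  using run k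
proof induction
  case start
  show ?case by (auto intro: exI[of _ 0])
next
  case (step k S R j)
  let ?T = "{j. X $ j \<noteq> 0}"
  let ?C = "(\<lambda>i. column i B) ` insert j S"
  obtain Z where S: "S \<subseteq> ?T" "card S = k" and orth: "\<forall>i\<in>S. herm_inner (column i B) R = 0"
    and Z: "{j. Z $ j \<noteq> 0} \<subseteq> S" "R = B *v (X - Z)"
    using step by auto
  \<comment> \<open>Before the last step some support index \<open>l\<close> is unselected;
    \<open>Z\<close> vanishes there and \<open>X\<close> does not.\<close>
  have "S \<noteq> ?T" using S step.prems by (auto simp: sparsity_def)
  then obtain l where l: "X $ l \<noteq> 0" "l \<notin> S" using S by auto
  then have "(X - Z) $ l \<noteq> 0" using Z by auto
  then have "X - Z \<noteq> 0" by (metis zero_index)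
  moreover have "{j. (X - Z) $ j \<noteq> 0} \<subseteq> ?T" using Z S by auto
  ultimately obtain i where i: "\<And>j. j \<notin> ?T \<Longrightarrow>
      norm (herm_inner (column j B) R) < norm (herm_inner (column i B) R)"
      "0 < norm (herm_inner (column i B) R)"
    using coherence_bound_dominant_correlation[OF coh, of ?T "X - Z"] s Z(2)
    by (metis sparsity_def)
  have max: "norm (herm_inner (column i B) R) \<le> norm (herm_inner (column j B) R)"
    by (rule step.hyps)
  have jT: "j \<in> ?T" using i(1)[of j] max by fastforce
  have jS: "j \<notin> S" using i(2) max orth by auto
  define p where "p = orth_proj (vec.span ?C) (B *v X)"
  \<comment> \<open>\<open>orth_proj\<close> is a definite description, so its properties come from
    unique existence.\<close>
  have p: "p \<in> vec.span ?C" "\<And>w. w \<in> vec.span ?C \<Longrightarrow> herm_inner w (B *v X - p) = 0"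
    using theI'[OF orth_proj_ex1[OF vec.subspace_span, of ?C "B *v X"]]
    by (simp_all add: p_def orth_proj_def)
  obtain V where V: "{l. V $ l \<noteq> 0} \<subseteq> insert j S" "p = B *v V"
    using vec_span_columns[OF p(1)] .
  have "insert j S \<subseteq> ?T" "card (insert j S) = Suc k"
    using jT jS S by (auto simp: card_insert_disjoint)
  moreover have "\<forall>i\<in>insert j S. herm_inner (column i B) (B *v X - p) = 0"
    by (auto intro!: p(2) vec.span_base)
  moreover have "B *v X - p = B *v (X - V)"
    using V by (simp add: matrix_vector_mult_diff_distrib)
  ultimately show ?case using V(1) unfolding p_def by blast
qed

text \<open>After \<open>sparsity X\<close> steps the selected set lies in the support and has its
  size, so it is the support. Independence of these columns makes the least-squares solution
  unique.\<close>

lemma coherence_bound_omp_recovers: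
  assumes coh: "coherence_bound B \<mu>" and s: "2 * real (sparsity X) * \<mu> < 1 + \<mu>"
  shows "omp_recovers B X"
  unfolding omp_recovers_def
proof (intro allI impI)
  fix S R assume run: "omp_run B (B *v X) (sparsity X) S R"
  have "S \<subseteq> {j. X $ j \<noteq> 0}" "card S = sparsity X"
    using omp_run_invariant[OF coh s run] by auto
  then have S: "S = {j. X $ j \<noteq> 0}"
    by (metis card_subset_eq finite sparsity_def)
  have inj: "Z = X" if "{j. Z $ j \<noteq> 0} \<subseteq> S" "B *v X = B *v Z" for Z
  proof (rule ccontr)
    assume "Z \<noteq> X"
    moreover have "B *v (Z - X) = 0" using that by (simp add: matrix_vector_mult_diff_distrib)
    moreover have "{j. (Z - X) $ j \<noteq> 0} \<subseteq> S" using that S by auto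
    ultimately show False
      using coherence_bound_dominant_correlation[OF coh, of S "Z - X"] s S
      by (metis sparsity_def herm_inner_zero_right norm_zero less_irrefl right_minus_eq)
  qed
  show "{Z. is_arg_min (\<lambda>Z. norm (B *v X - B *v Z)) (\<lambda>Z. {j. Z $ j \<noteq> 0} \<subseteq> S) Z} = {X}"
  proof (intro set_eqI iffI)
    fix Z assume "Z \<in> {Z. is_arg_min (\<lambda>Z. norm (B *v X - B *v Z)) (\<lambda>Z. {j. Z $ j \<noteq> 0} \<subseteq> S) Z}"
    \<comment> \<open>A minimizer is compared with \<open>X\<close> itself, which is feasible and
      has residual zero.\<close>
    then have Z: "{j. Z $ j \<noteq> 0} \<subseteq> S" "\<not> norm (B *v X - B *v X) < norm (B *v X - B *v Z)"
      using S by (auto simp: is_arg_min_def)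
    then have "B *v X = B *v Z" by simp
    with inj Z show "Z \<in> {X}" by blast
  qed (use S in \<open>auto simp: is_arg_min_def\<close>)
qed

section \<open>Sums of random characters\<close>

text \<open>Projecting on three axes rather than on the real and imaginary ones improves the exponent in the
  tail bound enough to absorb the constant factors of the union bound.\<close>

lemma norm_le_Re_three_axes:
  "\<exists>\<phi>\<in>{0, pi / 3, - (pi / 3)}. sqrt 3 / 2 * norm z \<le> \<bar>Re (cis \<phi> * z)\<bar>"
proof -
  define u v where "u = \<bar>Re z\<bar>" and "v = \<bar>Im z\<bar>"
  have nz: "norm z = sqrt (u\<^sup>2 + v\<^sup>2)" by (simp add: u_def v_def cmod_def)
  have uv: "u \<ge> 0" "v \<ge> 0" by (simp_all add: u_def v_def)
  have sq: "(sqrt 3 / 2 * norm z)\<^sup>2 = 3 / 4 * (u\<^sup>2 + v\<^sup>2)"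
    by (simp add: nz power_mult_distrib power_divide)
  show ?thesis
  \<comment> \<open>This asks whether \<open>z\<close> lies within 30 degrees of the real axis. The
    factor \<open>sqrt 3 / 2\<close> is the cosine of that angle.\<close>
  proof (cases "3 * v\<^sup>2 \<le> u\<^sup>2")
    case True
    then have "(sqrt 3 / 2 * norm z)\<^sup>2 \<le> u\<^sup>2" unfolding sq by simp
    then have "sqrt 3 / 2 * norm z \<le> u" using uv(1) by (rule power2_le_imp_le)
    then show ?thesis by (intro bexI[of _ 0]) (simp_all add: u_def)
  next
    case False
    then have "u\<^sup>2 \<le> (sqrt 3 * v)\<^sup>2" by (simp add: power_mult_distrib)
    then have le: "u \<le> sqrt 3 * v" by (rule power2_le_imp_le) (use uv in simp)
    have "(u / 2 + sqrt 3 / 2 * v)\<^sup>2 - 3 / 4 * (u\<^sup>2 + v\<^sup>2) = u * (sqrt 3 * v - u) / 2"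
      by (simp add: power2_eq_square field_simps)
    moreover have "0 \<le> u * (sqrt 3 * v - u)" using uv le by simp
    ultimately have "(sqrt 3 / 2 * norm z)\<^sup>2 \<le> (u / 2 + sqrt 3 / 2 * v)\<^sup>2" unfolding sq by linarith
    then have "sqrt 3 / 2 * norm z \<le> u / 2 + sqrt 3 / 2 * v"
      by (rule power2_le_imp_le) (use uv in simp)
    \<comment> \<open>Whether \<open>Re z\<close> and \<open>Im z\<close> have equal or opposite
      signs decides between the two slanted axes.\<close>
    moreover have "u / 2 + sqrt 3 / 2 * v = \<bar>Re z / 2 - sqrt 3 / 2 * Im z\<bar> \<or>
        u / 2 + sqrt 3 / 2 * v = \<bar>Re z / 2 + sqrt 3 / 2 * Im z\<bar>"
    proof -
      have "\<bar>p\<bar> + \<bar>q\<bar> = \<bar>p - q\<bar> \<or> \<bar>p\<bar> + \<bar>q\<bar> = \<bar>p + q\<bar>" for p q :: real by arith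
      from this[of "Re z / 2" "sqrt 3 / 2 * Im z"] show ?thesis
        by (simp add: u_def v_def abs_mult)
    qed
    ultimately show ?thesis
      by (auto simp: cos_60 sin_60)
  qed
qed

text \<open>A sum of norm above \<open>t\<close> has a projection of size at least
  \<open>sqrt 3 / 2 * t\<close> on one of three axes. Each projection is a sum of cosines in
  \<open>[-1, 1]\<close> with mean zero; the two-sided Hoeffding bound on three axes gives the
  factor 6. The mean is required for all \<phi> because projecting shifts the phase.\<close>

lemma (in prob_space) prob_norm_sum_cis_gt:
  assumes fin: "finite I" and ne: "I \<noteq> {}"
    and indep: "indep_vars (\<lambda>_. borel) \<theta> I"
    and mean: "\<And>i \<phi>. i \<in> I \<Longrightarrow> expectation (\<lambda>w. cos (\<phi> + \<theta> i w)) = 0"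
    and t: "t \<ge> 0"
  shows "prob {w \<in> space M. t < norm (\<Sum>i\<in>I. cis (\<theta> i w))} \<le> 6 * exp (- 3 * t\<^sup>2 / (8 * real (card I)))"
proof -
  define F where "F = {0, pi / 3, - (pi / 3)}"
  define Bad where "Bad \<phi> = {w \<in> space M. sqrt 3 / 2 * t \<le> \<bar>(\<Sum>i\<in>I. cos (\<phi> + \<theta> i w))\<bar>}" for \<phi>
  have [measurable]: "\<theta> i \<in> borel_measurable M" if "i \<in> I" for i
    using indep that by (auto simp: indep_vars_def)
  have Bad_sets: "Bad \<phi> \<in> events" for \<phi> unfolding Bad_def by measurable
  have tail: "prob (Bad \<phi>) \<le> 2 * exp (- 3 * t\<^sup>2 / (8 * real (card I)))" for \<phi>
  proof -
    have ind: "indep_vars (\<lambda>_. borel) (\<lambda>i w. cos (\<phi> + \<theta> i w)) I"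
      using indep by (rule indep_vars_compose2) auto
    interpret Hoeffding_ineq M I "\<lambda>i w. cos (\<phi> + \<theta> i w)" "\<lambda>_. -1" "\<lambda>_. 1" 0
      by unfold_locales (auto simp: fin ind mean)
    have card: "(\<Sum>i\<in>I. (1 - (-1 :: real))\<^sup>2) = 4 * real (card I)" by simp
    have "card I > 0" using fin ne by (simp add: card_gt_0_iff)
    then have "prob (Bad \<phi>) \<le> 2 * exp (- 2 * (sqrt 3 / 2 * t)\<^sup>2 / (4 * real (card I)))"
      using Hoeffding_ineq_abs_ge[of "sqrt 3 / 2 * t"] t unfolding card Bad_def by simp
    also have "- 2 * (sqrt 3 / 2 * t)\<^sup>2 / (4 * real (card I)) = - 3 * t\<^sup>2 / (8 * real (card I))"
      by (simp add: power_mult_distrib power_divide)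
    finally show ?thesis .
  qed
  have "{w \<in> space M. t < norm (\<Sum>i\<in>I. cis (\<theta> i w))} \<subseteq> (\<Union>\<phi>\<in>F. Bad \<phi>)"
  proof safe
    fix w assume w: "w \<in> space M" "t < norm (\<Sum>i\<in>I. cis (\<theta> i w))"
    obtain \<phi> where \<phi>: "\<phi> \<in> F" "sqrt 3 / 2 * norm (\<Sum>i\<in>I. cis (\<theta> i w)) \<le> \<bar>Re (cis \<phi> * (\<Sum>i\<in>I. cis (\<theta> i w)))\<bar>"
      using norm_le_Re_three_axes unfolding F_def by blast
    have eq: "Re (cis \<phi> * (\<Sum>i\<in>I. cis (\<theta> i w))) = (\<Sum>i\<in>I. cos (\<phi> + \<theta> i w))"
      by (simp only: sum_distrib_left cis_mult Re_sum cis.simps)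
    have "sqrt 3 / 2 * t \<le> sqrt 3 / 2 * norm (\<Sum>i\<in>I. cis (\<theta> i w))"
      using w by (intro mult_left_mono) auto
    from order_trans[OF this \<phi>(2)] have "w \<in> Bad \<phi>" using w(1) unfolding Bad_def eq by blast
    with \<phi>(1) show "w \<in> (\<Union>\<phi>\<in>F. Bad \<phi>)" by blast
  qed
  then have "prob {w \<in> space M. t < norm (\<Sum>i\<in>I. cis (\<theta> i w))} \<le> prob (\<Union>\<phi>\<in>F. Bad \<phi>)"
    using Bad_sets by (intro finite_measure_mono) (auto simp: F_def)
  also have "\<dots> \<le> (\<Sum>\<phi>\<in>F. prob (Bad \<phi>))"
    using Bad_sets by (intro finite_measure_subadditive_finite) (auto simp: F_def)
  also have "\<dots> \<le> (\<Sum>\<phi>\<in>F. 2 * exp (- 3 * t\<^sup>2 / (8 * real (card I))))"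
    by (intro sum_mono tail)
  also have "\<dots> = real (card F) * (2 * exp (- 3 * t\<^sup>2 / (8 * real (card I))))" by simp
  also have "\<dots> \<le> 3 * (2 * exp (- 3 * t\<^sup>2 / (8 * real (card I))))"
    unfolding F_def by (intro mult_right_mono) (auto simp: card_insert_if)
  finally show ?thesis by simp
qed

section \<open>Vanishing means of characters on the square\<close>

lemma integral_cos_full_periods:
  assumes "A > 0" and "h \<noteq> (0::int)"
  shows "(\<integral>x. indicator {0..A} x *\<^sub>R cos (c + 2 * pi * real_of_int h * x / A) \<partial>lborel) = 0"
proof -
  define k where "k = 2 * pi * real_of_int h / A"
  have k: "k \<noteq> 0" using assms by (simp add: k_def)
  have "(\<integral>x. indicator {0..A} x *\<^sub>R cos (c + k * x) \<partial>lborel) = sin (c + k * A) / k - sin (c + k * 0) / k"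
    using assms k
    by (intro integral_FTC_Icc)
       (auto intro!: derivative_eq_intros continuous_intros simp flip: has_real_derivative_iff_has_vector_derivative)
  also have "sin (c + k * A) = sin c"
    using assms sin_int_2pin[of h] cos_int_2pin[of h] by (simp add: k_def sin_add mult.assoc)
  finally show ?thesis by (simp add: k_def)
qed

text \<open>By Fubini, integrate first in a variable with nonzero frequency; the other variable is
  absorbed into the arbitrary phase of the one-dimensional lemma.\<close>

lemma integral_cos_full_periods_square:
  assumes A: "A > 0" and hg: "(h, g) \<noteq> (0::int, 0::int)"
  shows "(\<integral>z. indicator ({0..A} \<times> {0..A}) z *\<^sub>R
    cos (c + 2 * pi * (real_of_int h * fst z + real_of_int g * snd z) / A) \<partial>lborel) = 0"
proof -
  define f where "f x y = indicator ({0..A} \<times> {0..A}) (x, y) *\<^sub>R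
    cos (c + 2 * pi * (real_of_int h * x + real_of_int g * y) / A)" for x y
  have "integrable lborel (\<lambda>z. indicator ({0..A} \<times> {0..A}) z *\<^sub>R
      cos (c + 2 * pi * (real_of_int h * fst z + real_of_int g * snd z) / A))"
    using A by (intro borel_integrable_compact compact_Times) (auto intro!: continuous_intros)
  then have int: "integrable (lborel \<Otimes>\<^sub>M lborel) (case_prod f)"
    by (simp add: f_def lborel_prod case_prod_unfold)
  have "integral\<^sup>L (lborel \<Otimes>\<^sub>M lborel) (case_prod f) = 0"
  proof (cases "g = 0")
    case False
    have "(\<integral>y. f x y \<partial>lborel) = 0" for x
    proof -
      have "f x y = indicator {0..A} x * (indicator {0..A} y *\<^sub>R
          cos ((c + 2 * pi * real_of_int h * x / A) + 2 * pi * real_of_int g * y / A))" for y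
        by (auto simp: f_def indicator_def ring_distribs add_divide_distrib ac_simps)
      then show ?thesis
        using integral_cos_full_periods[OF A False] by simp
    qed
    then show ?thesis by (simp flip: lborel_pair.integral_fst[OF int])
  next
    case True
    then have "h \<noteq> 0" using hg by simp
    have "(\<integral>x. f x y \<partial>lborel) = 0" for y
    proof -
      have "f x y = indicator {0..A} y * (indicator {0..A} x *\<^sub>R
          cos ((c + 2 * pi * real_of_int g * y / A) + 2 * pi * real_of_int h * x / A))" for x
        by (auto simp: f_def indicator_def ring_distribs add_divide_distrib ac_simps)
      then show ?thesis
        using integral_cos_full_periods[OF A \<open>h \<noteq> 0\<close>] by simp
    qed
    then show ?thesis by (simp flip: lborel_pair.integral_snd[OF int])
  qed
  then show ?thesis by (simp add: f_def lborel_prod case_prod_unfold)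
qed

lemma (in prob_space) expectation_cos_uniform_square:
  assumes A: "A > 0" and hg: "(h, g) \<noteq> (0::int, 0::int)"
    and [measurable]: "a \<in> borel_measurable M"
    and distr: "distr M borel a = uniform_measure lborel ({0..A} \<times> {0..A})"
  shows "expectation (\<lambda>w. cos (c + 2 * pi * (real_of_int h * fst (a w) + real_of_int g * snd (a w)) / A)) = 0"
proof -
  let ?f = "\<lambda>z. cos (c + 2 * pi * (real_of_int h * fst z + real_of_int g * snd z) / A)"
  have [measurable]: "{0..A} \<times> {0..A} \<in> sets borel"
    by (intro borel_closed closed_Times) auto
  have em: "emeasure lborel ({0..A} \<times> {0..A}) = ennreal (A * A)"
    using A by (simp add: lborel_prod[symmetric] lborel.emeasure_pair_measure_Times ennreal_mult'')
  \<comment> \<open>\<open>integral_density\<close> needs a real-valued density, so the extended one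
    is rewritten.\<close>
  have g: "indicator S z / ennreal (A * A) = ennreal (indicator S z / (A * A))" for S and z :: "real \<times> real"
    using divide_ennreal[of 1 "A * A"] A by (cases "z \<in> S") simp_all
  have f: "?f \<in> borel_measurable borel"
    by (intro borel_measurable_continuous_onI continuous_intros) (use A in auto)
  have "expectation (\<lambda>w. ?f (a w)) = integral\<^sup>L (distr M borel a) ?f"
    by (rule integral_distr[symmetric]) (use f in auto)
  also have "distr M borel a = density lborel (\<lambda>z. ennreal (indicator ({0..A} \<times> {0..A}) z / (A * A)))"
    unfolding distr uniform_measure_def em g ..
  also have "integral\<^sup>L \<dots> ?f = (\<integral>z. (indicator ({0..A} \<times> {0..A}) z / (A * A)) *\<^sub>R ?f z \<partial>lborel)"
  proof (rule integral_density)
    show "?f \<in> borel_measurable lborel" using f by simp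
    show "(\<lambda>z. indicator ({0..A} \<times> {0..A}) z / (A * A)) \<in> borel_measurable lborel"
      by measurable
    show "AE z in lborel. 0 \<le> indicator ({0..A} \<times> {0..A}) z / (A * A)"
      using A by (intro AE_I2) simp
  qed
  also have "\<dots> = (\<integral>z. (indicator ({0..A} \<times> {0..A}) z *\<^sub>R ?f z) / (A * A) \<partial>lborel)"
    by (intro Bochner_Integration.integral_cong) auto
  also have "\<dots> = 0"
    using integral_cos_full_periods_square[OF A hg, of c] by simp
  finally show ?thesis .
qed

section \<open>Coherence of the response matrix\<close>

text \<open>The phase of an entry is a transmitter term plus a receiver term of the same form, so
  the double sum factors into a square. This brings the coherence down to order
  \<open>1 / n\<close>.\<close>

lemma herm_inner_rm_matrix_columns:
  fixes r :: "'m::finite \<Rightarrow> real \<times> real" and a :: "'n::finite \<Rightarrow> real \<times> real"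
  assumes z0: "z0 > 0"
  shows "herm_inner (column j (rm_matrix \<omega> z0 r a)) (column k (rm_matrix \<omega> z0 r a)) =
    ((\<Sum>p\<in>UNIV. cis (\<omega> / (2 * z0) * (((fst (r k) - fst (a p))\<^sup>2 + (snd (r k) - snd (a p))\<^sup>2)
      - ((fst (r j) - fst (a p))\<^sup>2 + (snd (r j) - snd (a p))\<^sup>2)))) / of_nat CARD('n))\<^sup>2"
proof -
  define \<psi> where "\<psi> i p = \<omega> / (2 * z0) * ((fst (r i) - fst (a p))\<^sup>2 + (snd (r i) - snd (a p))\<^sup>2)" for i p
  have entry: "rm_matrix \<omega> z0 r a $ (p, q) $ i =
      cis (2 * \<omega> * z0 + \<psi> i p + \<psi> i q) / of_nat CARD('n)" for p q i
    unfolding rm_matrix_entry[OF z0] cis_conv_exp[symmetric] \<psi>_def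
    by (simp add: cis_mult ring_distribs ac_simps)
  have "herm_inner (column j (rm_matrix \<omega> z0 r a)) (column k (rm_matrix \<omega> z0 r a)) =
      (\<Sum>(p, q)\<in>UNIV \<times> UNIV. cnj (rm_matrix \<omega> z0 r a $ (p, q) $ j) * rm_matrix \<omega> z0 r a $ (p, q) $ k)"
    by (simp add: herm_inner_def column_def case_prod_unfold)
  also have "\<dots> = (\<Sum>p\<in>UNIV. \<Sum>q\<in>UNIV. (cis (\<psi> k p - \<psi> j p) / of_nat CARD('n)) * (cis (\<psi> k q - \<psi> j q) / of_nat CARD('n)))"
    unfolding sum.cartesian_product[symmetric]
    by (simp add: entry cis_cnj cis_mult algebra_simps)
  also have "\<dots> = ((\<Sum>p\<in>UNIV. cis (\<psi> k p - \<psi> j p)) / of_nat CARD('n))\<^sup>2"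
    by (simp only: power2_eq_square sum_divide_distrib sum_product)
  finally show ?thesis unfolding \<psi>_def right_diff_distrib .
qed

text \<open>In the phase difference the squares of the sensor coordinates cancel. What remains is a
  constant \<open>C\<close> and a term linear in the sensor position that sees the targets only
  through their difference.\<close>

lemma rm_matrix_coherence_bound:
  fixes r :: "'m::finite \<Rightarrow> real \<times> real" and a :: "'n::finite \<Rightarrow> real \<times> real"
  assumes z0: "z0 > 0"
    and S: "\<And>j k. j \<noteq> k \<Longrightarrow> norm (\<Sum>p\<in>UNIV. cis (\<omega> / z0 *
      ((fst (r j) - fst (r k)) * fst (a p) + (snd (r j) - snd (r k)) * snd (a p)))) \<le> t"
  shows "coherence_bound (rm_matrix \<omega> z0 r a) ((t / real CARD('n))\<^sup>2)"
  unfolding coherence_bound_def herm_inner_rm_matrix_columns[OF z0]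
proof (intro conjI allI impI)
  fix j k :: 'm assume jk: "j \<noteq> k"
  define C where "C = \<omega> / (2 * z0) * ((fst (r k))\<^sup>2 - (fst (r j))\<^sup>2 + (snd (r k))\<^sup>2 - (snd (r j))\<^sup>2)"
  have "\<omega> / (2 * z0) * (((fst (r k) - fst (a p))\<^sup>2 + (snd (r k) - snd (a p))\<^sup>2)
      - ((fst (r j) - fst (a p))\<^sup>2 + (snd (r j) - snd (a p))\<^sup>2)) =
    C + \<omega> / z0 * ((fst (r j) - fst (r k)) * fst (a p) + (snd (r j) - snd (r k)) * snd (a p))" for p
    using z0 by (simp add: C_def field_simps power2_eq_square)
  then have "norm (\<Sum>p\<in>UNIV. cis (\<omega> / (2 * z0) * (((fst (r k) - fst (a p))\<^sup>2 + (snd (r k) - snd (a p))\<^sup>2)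
      - ((fst (r j) - fst (a p))\<^sup>2 + (snd (r j) - snd (a p))\<^sup>2))))
    = norm (cis C * (\<Sum>p\<in>UNIV. cis (\<omega> / z0 *
      ((fst (r j) - fst (r k)) * fst (a p) + (snd (r j) - snd (r k)) * snd (a p)))))"
    by (simp add: sum_distrib_left cis_mult)
  also have "\<dots> \<le> t" using S[OF jk] by (simp add: norm_mult)
  finally show "norm (((\<Sum>p\<in>UNIV. cis (\<omega> / (2 * z0) * (((fst (r k) - fst (a p))\<^sup>2 + (snd (r k) - snd (a p))\<^sup>2)
      - ((fst (r j) - fst (a p))\<^sup>2 + (snd (r j) - snd (a p))\<^sup>2)))) / of_nat CARD('n))\<^sup>2) \<le> (t / real CARD('n))\<^sup>2"
    unfolding norm_power norm_divide norm_of_nat by (intro power_mono divide_right_mono) auto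
\<comment> \<open>Left over are nonnegativity and the unit columns: for equal indices all phases
  vanish and the sum is \<open>CARD('n)\<close>.\<close>
qed auto

section \<open>Lattice differences and the union bound\<close>

definition nonzero_lattice_differences :: "nat \<Rightarrow> (int \<times> int) set" where
  "nonzero_lattice_differences N = ({1 - int N..int N - 1} \<times> {1 - int N..int N - 1}) - {(0, 0)}"

lemma finite_nonzero_lattice_differences [simp]: "finite (nonzero_lattice_differences N)"
  by (simp add: nonzero_lattice_differences_def)

text \<open>The count is linear in the number \<open>N^2\<close> of targets, whereas the number of
  pairs is quadratic. This is the saving in the union bound.\<close>

lemma card_nonzero_lattice_differences:
  assumes "N > 0"
  shows "real (card (nonzero_lattice_differences N)) = 4 * (real N * (real N - 1))"
proof -
  have "card (nonzero_lattice_differences N) = (2 * N - 1) * (2 * N - 1) - 1"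
    using assms by (auto simp: nonzero_lattice_differences_def card_Diff_singleton card_cartesian_product nat_diff_distrib nat_add_distrib nat_mult_distrib)
  moreover have "(2 * N - 1) * (2 * N - 1) \<ge> 1" using assms by simp
  moreover have "real (2 * N - 1) = 2 * real N - 1" using assms by (simp add: of_nat_diff)
  ultimately show ?thesis by (simp add: of_nat_diff algebra_simps)
qed

lemma square_lattice_differences:
  assumes "square_lattice ell (r :: 'm::finite \<Rightarrow> real \<times> real)"
  obtains N where "CARD('m) = N\<^sup>2"
    "\<And>j k. j \<noteq> k \<Longrightarrow> \<exists>h g. (h, g) \<in> nonzero_lattice_differences N \<and>
      fst (r j) - fst (r k) = ell * real_of_int h \<and> snd (r j) - snd (r k) = ell * real_of_int g"
proof -
  obtain N x0 y0 where N: "CARD('m) = N\<^sup>2"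
    and bij: "bij_betw r UNIV
      ((\<lambda>(k, l). (x0 + real k * ell, y0 + real l * ell)) ` ({..<N} \<times> {..<N}))"
    using assms unfolding square_lattice_def by blast
  have ex: "\<exists>u v. u < N \<and> v < N \<and> r j = (x0 + real u * ell, y0 + real v * ell)" for j
  proof -
    have "r j \<in> (\<lambda>(k, l). (x0 + real k * ell, y0 + real l * ell)) ` ({..<N} \<times> {..<N})"
      using bij by (auto simp: bij_betw_def)
    then show ?thesis by auto
  qed
  have "\<exists>h g. (h, g) \<in> nonzero_lattice_differences N \<and>
      fst (r j) - fst (r k) = ell * real_of_int h \<and> snd (r j) - snd (r k) = ell * real_of_int g"
    if "j \<noteq> k" for j k
  proof -
    obtain u v u' v' where j: "u < N" "v < N" "r j = (x0 + real u * ell, y0 + real v * ell)"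
      and k: "u' < N" "v' < N" "r k = (x0 + real u' * ell, y0 + real v' * ell)"
      using ex[of j] ex[of k] by blast
    have "r j \<noteq> r k" using bij that by (auto simp: bij_betw_def inj_on_def)
    then have "(u, v) \<noteq> (u', v')" using j k by auto
    then have "(int u - int u', int v - int v') \<in> nonzero_lattice_differences N"
      using j k by (auto simp: nonzero_lattice_differences_def)
    then show ?thesis using j k
      by (intro exI[of _ "int u - int u'"] exI[of _ "int v - int v'"]) (simp add: algebra_simps)
  qed
  with N show ?thesis using that by blast
qed

text \<open>With \<open>y = exp (- K\<^sup>2 / 4)\<close> the tail is \<open>y^3\<close> and the
  hypothesis reads \<open>N^2 * y^2 \<le> \<delta> / 2\<close>. After multiplication by
  \<open>N^2\<close> the left side is \<open>24 * (N - 1) * (N * y) * (N^2 * y^2)\<close>, at most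
  \<open>6 * (N - 1) * \<delta>\<close>.\<close>

lemma lattice_union_bound:
  assumes N: "N > 0" and \<delta>: "0 < \<delta>" "\<delta> \<le> 1 / 2"
    and m: "real N ^ 2 \<le> \<delta> / 2 * exp (K\<^sup>2 / 2)"
  shows "4 * (real N * (real N - 1)) * (6 * exp (- 3 * K\<^sup>2 / 4)) < 2 * \<delta>"
proof -
  define y where "y = exp (- K\<^sup>2 / 4)"
  have y0: "y > 0" by (simp add: y_def)
  have y2: "y\<^sup>2 = exp (- K\<^sup>2 / 2)" by (simp add: y_def flip: exp_double)
  have y3: "exp (- 3 * K\<^sup>2 / 4) = y * y\<^sup>2" unfolding y2 by (simp add: y_def flip: exp_add)
  have n: "real N \<ge> 1" using N by simp
  have *: "real N ^ 2 * y\<^sup>2 \<le> \<delta> / 2"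
    using mult_right_mono[OF m, of "y\<^sup>2"] by (simp add: y2 mult.assoc flip: exp_add)
  \<comment> \<open>Here \<open>\<delta> \<le> 1 / 2\<close> enters: \<open>\<delta> / 2\<close> is
    at most 1/4.\<close>
  have "(real N * y)\<^sup>2 \<le> (1 / 2)\<^sup>2" using * \<delta> by (simp add: power_mult_distrib power_divide)
  then have ny: "real N * y \<le> 1 / 2" by (rule power2_le_imp_le) simp
  have "4 * (real N * (real N - 1)) * (6 * exp (- 3 * K\<^sup>2 / 4)) * real N
      = 24 * (real N - 1) * (real N * y) * (real N * y\<^sup>2)" unfolding y3 by (simp add: algebra_simps)
  also have "\<dots> \<le> 24 * (real N - 1) * (1 / 2) * (real N * y\<^sup>2)"
    using n ny by (intro mult_right_mono mult_left_mono) auto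
  finally have "4 * (real N * (real N - 1)) * (6 * exp (- 3 * K\<^sup>2 / 4)) * real N * real N
      \<le> 24 * (real N - 1) * (1 / 2) * (real N * y\<^sup>2) * real N"
    using n by (intro mult_right_mono) auto
  also have "\<dots> = 12 * (real N - 1) * (real N ^ 2 * y\<^sup>2)" by (simp add: power2_eq_square)
  also have "\<dots> \<le> 12 * (real N - 1) * (\<delta> / 2)"
    using n * by (intro mult_left_mono) auto
  also have "\<dots> = \<delta> * (6 * (real N - 1))" by simp
  also have "\<dots> < \<delta> * (2 * real N * real N)"
  proof (intro mult_strict_left_mono \<delta>)
    \<comment> \<open>This is eight times the difference of the two sides.\<close>
    have "0 < (4 * real N - 6)\<^sup>2 + 12" by (simp add: add_nonneg_pos)
    then show "6 * (real N - 1) < 2 * real N * real N" by (simp add: power2_eq_square algebra_simps)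
  qed
  finally have "4 * (real N * (real N - 1)) * (6 * exp (- 3 * K\<^sup>2 / 4)) * (real N * real N) < 2 * \<delta> * (real N * real N)"
    by (simp add: mult_ac)
  then show ?thesis using n by (subst (asm) mult_less_cancel_right_pos) auto
qed

text \<open>Multiplication by \<open>L \<noteq> 0\<close> keeps nonzero differences nonzero, so
  every frequency in \<open>D\<close> gives mean-zero summands and the tail bound applies to
  each.\<close>

lemma (in prob_space) prob_lattice_exponential_sums:
  fixes a :: "'n::finite \<Rightarrow> 'a \<Rightarrow> real \<times> real"
  assumes A: "A > 0" and L: "L \<noteq> (0::int)" and t: "t \<ge> 0"
    and indep: "indep_vars (\<lambda>_. borel) a UNIV"
    and distr: "\<And>q. distr M borel (a q) = uniform_measure lborel ({0..A} \<times> {0..A})"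
    and D: "finite D" "(0, 0) \<notin> D"
  defines "E \<equiv> {w \<in> space M. \<forall>(h, g)\<in>D. norm (\<Sum>q\<in>UNIV. cis (2 * pi *
    (real_of_int (L * h) * fst (a q w) + real_of_int (L * g) * snd (a q w)) / A)) \<le> t}"
  shows "E \<in> events" "prob E \<ge> 1 - real (card D) * (6 * exp (- 3 * t\<^sup>2 / (8 * real CARD('n))))"
proof -
  define \<theta> where "\<theta> d q w = 2 * pi *
    (real_of_int (L * fst d) * fst (a q w) + real_of_int (L * snd d) * snd (a q w)) / A" for d q w
  define Bad where "Bad d = {w \<in> space M. t < norm (\<Sum>q\<in>UNIV. cis (\<theta> d q w))}" for d
  have rv [measurable]: "a q \<in> borel_measurable M" for q
    using indep by (auto simp: indep_vars_def)
  have lin: "(\<lambda>z. 2 * pi * (u * fst z + v * snd z) / A) \<in> borel_measurable borel" for u v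
    by (intro borel_measurable_continuous_onI continuous_intros) (use A in auto)
  have \<theta>_indep: "indep_vars (\<lambda>_. borel) (\<theta> d) UNIV" for d
    unfolding \<theta>_def by (rule indep_vars_compose2[OF indep]) (rule lin)
  then have [measurable]: "\<theta> d q \<in> borel_measurable M" for d q
    by (auto simp: indep_vars_def)
  have cis_meas: "cis \<in> borel_measurable borel"
    by (intro borel_measurable_continuous_onI continuous_intros)
  have "(\<lambda>w. cis (\<theta> d q w)) \<in> borel_measurable M" for d q
    by (rule measurable_compose[OF _ cis_meas]) measurable
  then have Bad_sets: "Bad d \<in> events" for d
    unfolding Bad_def by measurable
  have bad: "prob (Bad d) \<le> 6 * exp (- 3 * t\<^sup>2 / (8 * real CARD('n)))" if d: "d \<in> D" for d
    unfolding Bad_def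
  proof (rule prob_norm_sum_cis_gt[where I = "UNIV :: 'n set" and \<theta> = "\<theta> d"])
    fix q :: 'n and \<phi>
    have "(L * fst d, L * snd d) \<noteq> (0, 0)" using d D L by (cases d) auto
    then show "expectation (\<lambda>w. cos (\<phi> + \<theta> d q w)) = 0"
      unfolding \<theta>_def by (rule expectation_cos_uniform_square[OF A _ rv distr])
  qed (use t \<theta>_indep in auto)
  have E: "E = space M - (\<Union>d\<in>D. Bad d)"
    unfolding E_def Bad_def \<theta>_def by (auto simp: not_less case_prod_unfold)
  have U: "(\<Union>d\<in>D. Bad d) \<in> events" using D Bad_sets by (intro sets.finite_UN) auto
  then show "E \<in> events" unfolding E by auto
  have "prob (\<Union>d\<in>D. Bad d) \<le> (\<Sum>d\<in>D. prob (Bad d))"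
    using D Bad_sets by (intro finite_measure_subadditive_finite) auto
  also have "\<dots> \<le> (\<Sum>d\<in>D. 6 * exp (- 3 * t\<^sup>2 / (8 * real CARD('n))))"
    by (intro sum_mono bad)
  finally show "prob E \<ge> 1 - real (card D) * (6 * exp (- 3 * t\<^sup>2 / (8 * real CARD('n))))"
    unfolding E using prob_compl[OF U] by simp
qed

section \<open>Choice of parameters and conclusion\<close>

theorem mainTheorem7:
  fixes z0 ell A lam \<omega> \<rho> \<delta> K :: real
    and r :: "'m::finite \<Rightarrow> real \<times> real"
    and M :: "'a measure"
    and a :: "'n::finite \<Rightarrow> 'a \<Rightarrow> real \<times> real"
  assumes "z0 > 0" and "ell > 0" and "A > 0" and "lam > 0"
    and "\<omega> = 2 * pi / lam"
    and "square_lattice ell r"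
    and "prob_space M"
    and "prob_space.indep_vars M (\<lambda>_. borel) a UNIV"
    and "\<And>q. distr M borel (a q) = uniform_measure lborel ({0..A} \<times> {0..A})"
    and "\<rho> = lam * z0 / (ell * A)"
    and "1 / \<rho> \<in> \<nat>"
    and "\<delta> > 0" and "K > 0"
    and "real CARD('m) \<le> \<delta> / 2 * exp (K\<^sup>2 / 2)"
  shows "\<exists>E \<in> sets M.
    measure M E > 1 - 2 * \<delta>
      - \<rho> * real CARD('n) ^ 2 * ((real CARD('n))\<^sup>2 - 1) powr (3 / 2) / sqrt (real CARD('m)) \<and>
    (\<forall>w \<in> E. \<forall>X :: complex^'m.
      real (sparsity X) < 1 / 2 * (1 + real CARD('n) / (2 * K\<^sup>2)) \<longrightarrow>
        bp_recovers (rm_matrix \<omega> z0 r (\<lambda>q. a q w)) X \<and>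
        omp_recovers (rm_matrix \<omega> z0 r (\<lambda>q. a q w)) X)"
proof -
  interpret prob_space M by fact
  have \<rho>: "\<rho> > 0" using assms(1-4,10) by simp
  define excess where
    "excess = \<rho> * real CARD('n) ^ 2 * ((real CARD('n))\<^sup>2 - 1) powr (3 / 2) / sqrt (real CARD('m))"
  have excess: "excess \<ge> 0" unfolding excess_def using \<rho> by simp
  show ?thesis
  proof (cases "\<delta> \<le> 1 / 2")
    case False
    \<comment> \<open>For \<open>\<delta> > 1 / 2\<close> the claimed bound is negative, so the
      empty event suffices.\<close>
    then show ?thesis using excess by (intro bexI[of _ "{}"]) (auto simp: excess_def)
  next
    case \<delta>: True
    obtain N where N: "CARD('m) = N\<^sup>2"
      and diff: "\<And>j k. j \<noteq> k \<Longrightarrow> \<exists>h g. (h, g) \<in> nonzero_lattice_differences N \<and>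
        fst (r j) - fst (r k) = ell * real_of_int h \<and> snd (r j) - snd (r k) = ell * real_of_int g"
      using square_lattice_differences[OF assms(6)] by blast
    have Npos: "N > 0" using N by (metis gr0I power2_eq_square mult_0 zero_less_card_finite less_irrefl)
    obtain l where l: "1 / \<rho> = real l" using assms(11) by (auto elim: Nats_cases)
    \<comment> \<open>\<open>L\<close> is \<open>1 / \<rho>\<close>; its integrality turns the
      lattice frequencies into integer multiples of \<open>2 * pi / A\<close>.\<close>
    define L where "L = int l"
    have L: "L \<noteq> 0" "real_of_int L = ell * A / (lam * z0)"
    proof -
      show "L \<noteq> 0" using l \<rho> by (cases "l = 0") (simp_all add: L_def)
      show "real_of_int L = ell * A / (lam * z0)" using l by (simp add: L_def assms(10))
    qed
    \<comment> \<open>This \<open>t\<close> makes the tail exponent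
      \<open>- 3 * K\<^sup>2 / 4\<close> and the coherence
      \<open>(t / n)\<^sup>2 = 2 * K\<^sup>2 / n\<close>.\<close>
    define t where "t = sqrt (2 * real CARD('n)) * K"
    have t: "t \<ge> 0" "t\<^sup>2 = 2 * K\<^sup>2 * real CARD('n)"
      using \<open>K > 0\<close> by (simp_all add: t_def power_mult_distrib)
    define E where "E = {w \<in> space M. \<forall>(h, g)\<in>nonzero_lattice_differences N.
      norm (\<Sum>q\<in>UNIV. cis (2 * pi * (real_of_int (L * h) * fst (a q w) + real_of_int (L * g) * snd (a q w)) / A)) \<le> t}"
    have E: "E \<in> events" "prob E \<ge> 1 - real (card (nonzero_lattice_differences N))
        * (6 * exp (- 3 * t\<^sup>2 / (8 * real CARD('n))))"
      unfolding E_def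
      by (rule prob_lattice_exponential_sums[OF \<open>A > 0\<close> L(1) t(1) assms(8,9)];
          simp add: nonzero_lattice_differences_def)+
    have exponent: "- 3 * t\<^sup>2 / (8 * real CARD('n)) = - 3 * K\<^sup>2 / 4" by (simp add: t)
    have "prob E > 1 - 2 * \<delta>"
      using E(2)[unfolded exponent] lattice_union_bound[OF Npos \<open>\<delta> > 0\<close> \<delta>, of K] assms(14)
      by (simp add: card_nonzero_lattice_differences[OF Npos] N)
    then have "prob E > 1 - 2 * \<delta> - excess" using excess by simp
    moreover have "bp_recovers (rm_matrix \<omega> z0 r (\<lambda>q. a q w)) X \<and> omp_recovers (rm_matrix \<omega> z0 r (\<lambda>q. a q w)) X"
      if w: "w \<in> E" and X: "real (sparsity X) < 1 / 2 * (1 + real CARD('n) / (2 * K\<^sup>2))"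
      for w and X :: "complex^'m"
    proof -
      have "coherence_bound (rm_matrix \<omega> z0 r (\<lambda>q. a q w)) ((t / real CARD('n))\<^sup>2)"
      proof (rule rm_matrix_coherence_bound[OF \<open>z0 > 0\<close>])
        fix j k :: 'm assume "j \<noteq> k"
        then obtain h g where hg: "(h, g) \<in> nonzero_lattice_differences N"
          "fst (r j) - fst (r k) = ell * real_of_int h" "snd (r j) - snd (r k) = ell * real_of_int g"
          using diff by blast
        have "\<omega> / z0 * (ell * real_of_int h * fst (a p w) + ell * real_of_int g * snd (a p w)) =
            2 * pi * (real_of_int (L * h) * fst (a p w) + real_of_int (L * g) * snd (a p w)) / A" for p
          using assms(1-4) by (simp add: L(2) assms(5) field_simps)
        then show "norm (\<Sum>p\<in>UNIV. cis (\<omega> / z0 * ((fst (r j) - fst (r k)) * fst (a p w)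
            + (snd (r j) - snd (r k)) * snd (a p w)))) \<le> t"
          using w hg(1) unfolding E_def hg(2,3) by auto
      qed
      also have "(t / real CARD('n))\<^sup>2 = 2 * K\<^sup>2 / real CARD('n)"
        unfolding power_divide t(2) by (simp add: power2_eq_square)
      finally have coh: "coherence_bound (rm_matrix \<omega> z0 r (\<lambda>q. a q w)) (2 * K\<^sup>2 / real CARD('n))" .
      \<comment> \<open>With \<open>\<mu> = 2 * K\<^sup>2 / n\<close> the sparsity hypothesis is
        \<open>s < (1 + 1 / \<mu>) / 2\<close>; multiply by \<open>2 * \<mu>\<close>.\<close>
      have "2 * real (sparsity X) * (2 * K\<^sup>2 / real CARD('n)) < 1 + 2 * K\<^sup>2 / real CARD('n)"
        using X \<open>K > 0\<close> by (simp add: field_simps)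
      with coh show ?thesis
        by (blast intro: coherence_bound_bp_recovers coherence_bound_omp_recovers)
    qed
    ultimately show ?thesis using E(1) unfolding excess_def by blast
  qed
qed

end
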